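(* For every integer $n\geq 3$, every element of $$\mathcal{CD}(n)=\Bigl\{\frac{3n-2}{n^2},\ \frac{3n}{n^2},\ \frac{3n+2}{n^2},\ \ldots,\ \frac{n^2-2}{n^2}\Bigr\}$$ is achieved as a commuting degree by a BCK-algebra of order $n$; that is, for every $r\in\mathcal{CD}(n)$ there is a BCK-algebra $\mathbf{A}$ with $|\mathbf{A}|=n$ and $\operatorname{cd}(\mathbf{A})=r$.
   Context: A BCK-algebra is an algebra $\mathbf{A}=\langle A;\cdot,0\rangle$ of type $(2,0)$ such that for all $x,y,z\in A$: (BCK1) $[(x\cdot y)\cdot(x\cdot z)]\cdot(z\cdot y)=0$; (BCK2) $[x\cdot(x\cdot y)]\cdot y=0$; (BCK3) $x\cdot x=0$; (BCK4) $0\cdot x=0$; (BCK5) $x\cdot y=0$ and $y\cdot x=0$ imply $x=y$. The order of $\mathbf{A}$ is $|\mathbf{A}|=|A|$. Define $x\wedge y:=y\cdot(y\cdot x)$. Elements $x,y$ commute if $x\wedge y=y\wedge x$. For a finite BCK-algebra $\mathbf{A}$, let $C(\mathbf{A})=\{(x,y)\in A^2 : x\wedge y=y\wedge x\}$; the commuting degree of $\mathbf{A}$ is $\operatorname{cd}(\mathbf{A})=\frac{|C(\mathbf{A})|}{|\mathbf{A}|^2}$. In the set $\mathcal{CD}(n)$ the numerators increase in steps of $2$ from $3n-2$ to $n^2-2$ (these two integers have the same parity). Equivalently, $\mathcal{CD}(n)=\bigl\{\frac{n^2-2k}{n^2} : k\in\mathbb{Z},\ 1\leq k\leq T_{n-2}\bigr\}$,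 where $T_{n-2}=\frac{(n-2)(n-1)}{2}$. *)

theory Defs
  imports Complex_Main
begin

locale bck_algebra =
  fixes A :: "'a set" and mult :: "'a \<Rightarrow> 'a \<Rightarrow> 'a" (infixl "\<cdot>" 70) and zero :: 'a ("\<zero>")
  assumes mult_closed: "x \<in> A \<Longrightarrow> y \<in> A \<Longrightarrow> x \<cdot> y \<in> A"
    and zero_closed: "\<zero> \<in> A"
    and BCK1: "x \<in> A \<Longrightarrow> y \<in> A \<Longrightarrow> z \<in> A \<Longrightarrow> ((x \<cdot> y) \<cdot> (x \<cdot> z)) \<cdot> (z \<cdot> y) = \<zero>"
    and BCK2: "x \<in> A \<Longrightarrow> y \<in> A \<Longrightarrow> (x \<cdot> (x \<cdot> y)) \<cdot> y = \<zero>"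
    and BCK3: "x \<in> A \<Longrightarrow> x \<cdot> x = \<zero>"
    and BCK4: "x \<in> A \<Longrightarrow> \<zero> \<cdot> x = \<zero>"
    and BCK5: "x \<in> A \<Longrightarrow> y \<in> A \<Longrightarrow> x \<cdot> y = \<zero> \<Longrightarrow> y \<cdot> x = \<zero> \<Longrightarrow> x = y"

text \<open>The operation \<open>x \<and> y = y \<cdot> (y \<cdot> x)\<close>; note the order of the arguments.\<close>

definition bck_meet :: "('a \<Rightarrow> 'a \<Rightarrow> 'a) \<Rightarrow> 'a \<Rightarrow> 'a \<Rightarrow> 'a" where
  "bck_meet mult x y = mult y (mult y x)"

definition commuting_pairs :: "'a set \<Rightarrow> ('a \<Rightarrow> 'a \<Rightarrow> 'a) \<Rightarrow> ('a \<times> 'a) set" where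
  "commuting_pairs A mult = {(x, y) \<in> A \<times> A. bck_meet mult x y = bck_meet mult y x}"

definition commuting_degree :: "'a set \<Rightarrow> ('a \<Rightarrow> 'a \<Rightarrow> 'a) \<Rightarrow> real" where
  "commuting_degree A mult = real (card (commuting_pairs A mult)) / (real (card A))\<^sup>2"

text \<open>The numerators are \<open>3n - 2, 3n, 3n + 2, \<dots>, n\<^sup>2 - 2\<close>, taken in the integers
  so that subtraction is not truncated.\<close>

definition CD :: "nat \<Rightarrow> real set" where
  "CD n = {real_of_int (3 * int n - 2 + 2 * int j) / (real n)\<^sup>2 | j :: nat.
             3 * int n - 2 + 2 * int j \<le> (int n)\<^sup>2 - 2}"

text \<open>The same set, counted down from the largest numerator.\<close>

lemma CD_altdef:
  assumes "n \<ge> 3"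
  shows "CD n = {((real n)\<^sup>2 - 2 * real_of_int k) / (real n)\<^sup>2 | k :: int.
                   1 \<le> k \<and> k \<le> (int n - 2) * (int n - 1) div 2}"
proof -
  define T where "T = (int n - 2) * (int n - 1) div 2"
  have "even ((int n - 2) * (int n - 1))" by simp
  then have "2 * T = (int n - 2) * (int n - 1)" unfolding T_def by simp
  then have T: "2 * T = (int n)\<^sup>2 - 3 * int n + 2"
    by (simp add: algebra_simps power2_eq_square)
  have num: "real_of_int (3 * int n - 2 + 2 * (T - k)) = (real n)\<^sup>2 - 2 * real_of_int k" for k
  proof -
    have "3 * int n - 2 + 2 * (T - k) = (int n)\<^sup>2 - 2 * k" using T by (simp add: algebra_simps)
    then show ?thesis by (simp only: of_int_diff of_int_mult of_int_power of_int_of_nat_eq of_int_numeral)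
  qed
  have "CD n = {((real n)\<^sup>2 - 2 * real_of_int k) / (real n)\<^sup>2 | k :: int. 1 \<le> k \<and> k \<le> T}"
    (is "_ = ?R")
  proof (intro equalityI subsetI)
    fix r assume "r \<in> CD n"
    then obtain j :: nat where r: "r = real_of_int (3 * int n - 2 + 2 * int j) / (real n)\<^sup>2"
      and j: "3 * int n - 2 + 2 * int j \<le> (int n)\<^sup>2 - 2" unfolding CD_def by blast
    have "1 \<le> T - int j \<and> T - int j \<le> T" using T j by linarith
    moreover have "r = ((real n)\<^sup>2 - 2 * real_of_int (T - int j)) / (real n)\<^sup>2"
      using r num[of "T - int j"] by simp
    ultimately show "r \<in> ?R" by blast
  next
    fix r assume "r \<in> ?R"
    then obtain k where r: "r = ((real n)\<^sup>2 - 2 * real_of_int k) / (real n)\<^sup>2"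
      and k: "1 \<le> k" "k \<le> T" by blast
    have "3 * int n - 2 + 2 * int (nat (T - k)) \<le> (int n)\<^sup>2 - 2" using T k by simp
    moreover have "r = real_of_int (3 * int n - 2 + 2 * int (nat (T - k))) / (real n)\<^sup>2"
      using r num[of k] k by simp
    ultimately show "r \<in> CD n" unfolding CD_def by blast
  qed
  then show ?thesis unfolding T_def .
qed

end

theory Submission
  imports Defs
begin

text \<open>Every poset with a least element \<open>0\<close> is a BCK-algebra under \<open>x \<cdot> y = 0\<close> if \<open>x \<le> y\<close> and
  \<open>x \<cdot> y = x\<close> otherwise, and two elements fail to commute exactly when they are distinct, nonzero
  and comparable. Starting from \<open>{0}\<close> and adding the elements \<open>1, \<dots>, n - 1\<close> one at a time, each
  either as a new top or as a new atom incomparable to the earlier nonzero elements, the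
  element \<open>y\<close> contributes \<open>y - 1\<close> or no comparable pairs. Hence the possible numbers of comparable
  pairs are the subset sums of \<open>{0, \<dots>, n - 2}\<close>, which are all integers from \<open>0\<close> to \<open>T\<^sub>n\<^sub>-\<^sub>2\<close>.\<close>

definition poset_mult :: "('a \<Rightarrow> 'a \<Rightarrow> bool) \<Rightarrow> 'a \<Rightarrow> 'a \<Rightarrow> 'a \<Rightarrow> 'a" where
  "poset_mult le z x y = (if le x y then z else x)"

lemma bck_algebra_poset_mult:
  assumes "z \<in> A"
    and least: "\<And>x. x \<in> A \<Longrightarrow> le z x"
    and refl: "\<And>x. x \<in> A \<Longrightarrow> le x x"
    and trans: "\<And>x y w. x \<in> A \<Longrightarrow> y \<in> A \<Longrightarrow> w \<in> A \<Longrightarrow> le x y \<Longrightarrow> le y w \<Longrightarrow> le x w"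
    and antisym: "\<And>x y. x \<in> A \<Longrightarrow> y \<in> A \<Longrightarrow> le x y \<Longrightarrow> le y x \<Longrightarrow> x = y"
  shows "bck_algebra A (poset_mult le z) z"
proof
  fix x y assume "x \<in> A" "y \<in> A" "poset_mult le z x y = z" "poset_mult le z y x = z"
  then show "x = y"
    using antisym least by (auto simp: poset_mult_def split: if_splits)
next
  fix x y w assume "x \<in> A" "y \<in> A" "w \<in> A"
  \<comment> \<open>For BCK1, the left factor differs from \<open>z\<close> only if \<open>x\<close>
    lies below \<open>w\<close> but not below \<open>y\<close>, and is then \<open>x\<close>. By
    transitivity \<open>w\<close> is not below \<open>y\<close>, so the right factor is
    \<open>w\<close>, which is above \<open>x\<close>.\<close>
  then show "poset_mult le z (poset_mult le z (poset_mult le z x y) (poset_mult le z x w))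
      (poset_mult le z w y) = z"
    using assms(1) least refl trans[of x w y] by (auto simp: poset_mult_def)
qed (use assms(1) least refl in \<open>auto simp: poset_mult_def\<close>)

text \<open>If \<open>x\<close> is strictly below \<open>y\<close> and not \<open>z\<close>, the two
  meets are \<open>z\<close> and \<open>x\<close>; for incomparable elements both are
  \<open>z\<close>.\<close>

lemma poset_mult_commute_iff:
  assumes "le x x" "le y y" "le z x" "le z y"
    and "le x y \<Longrightarrow> le y x \<Longrightarrow> x = y" "le x z \<Longrightarrow> x = z" "le y z \<Longrightarrow> y = z"
  shows "bck_meet (poset_mult le z) x y = bck_meet (poset_mult le z) y x \<longleftrightarrow>
    x = y \<or> x = z \<or> y = z \<or> (\<not> le x y \<and> \<not> le y x)"
  using assms by (auto simp: bck_meet_def poset_mult_def)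

text \<open>Greedy choice: take the largest available number if it is at most \<open>k\<close> and
  recurse on the remainder; otherwise \<open>k\<close> itself is available.\<close>

lemma subset_sum_lessThan:
  fixes k m :: nat
  assumes "k \<le> \<Sum>{..<m}"
  shows "\<exists>S \<subseteq> {..<m}. \<Sum>S = k"
  using assms
proof (induction m arbitrary: k)
  case 0
  then show ?case by auto
next
  case (Suc m)
  show ?case
  proof (cases "m \<le> k")
    case True
    with Suc.prems have "k - m \<le> \<Sum>{..<m}" by simp
    then obtain S where S: "S \<subseteq> {..<m}" "\<Sum>S = k - m" using Suc.IH by blast
    moreover from S(1) have "finite S" "m \<notin> S" by (auto intro: finite_subset)
    ultimately have "\<Sum>(insert m S) = k" "insert m S \<subseteq> {..<Suc m}" using True by auto
    then show ?thesis by blast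
  next
    case False
    then show ?thesis by (intro exI[of _ "{k}"]) auto
  qed
qed

text \<open>The elements of \<open>S\<close> are the ones that were added as a new top.\<close>

definition top_le :: "nat set \<Rightarrow> nat \<Rightarrow> nat \<Rightarrow> bool" where
  "top_le S x y \<longleftrightarrow> x = 0 \<or> x = y \<or> (x < y \<and> y \<in> S)"

lemma bck_algebra_top_le:
  assumes "n > 0"
  shows "bck_algebra {..<n} (poset_mult (top_le S) 0) 0"
  by (rule bck_algebra_poset_mult) (use assms in \<open>auto simp: top_le_def\<close>)

lemma card_commuting_pairs_top_le:
  assumes "S \<subseteq> {..<n}"
  shows "card (commuting_pairs {..<n} (poset_mult (top_le S) 0)) + 2 * (\<Sum>y\<in>S. y - 1) = n\<^sup>2"
proof -
  define C where "C = commuting_pairs {..<n} (poset_mult (top_le S) 0)"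
  \<comment> \<open>The noncommuting pairs, larger element first. If \<open>0\<close> is in
    \<open>S\<close> it adds nothing: \<open>{1..<0}\<close> is empty and \<open>0 - 1\<close> is
    \<open>0\<close>.\<close>
  define U where "U = Sigma S (\<lambda>y. {1..<y})"
  have "finite S" using assms finite_subset by blast
  then have U: "finite U" "card U = (\<Sum>y\<in>S. y - 1)" unfolding U_def by auto
  have "bck_meet (poset_mult (top_le S) 0) x y = bck_meet (poset_mult (top_le S) 0) y x
      \<longleftrightarrow> (x, y) \<notin> U \<union> U\<inverse>" for x y
    by (subst poset_mult_commute_iff) (auto simp: top_le_def U_def)
  then have C: "C = {..<n} \<times> {..<n} - (U \<union> U\<inverse>)"
    unfolding C_def commuting_pairs_def by auto
  have sub: "U \<union> U\<inverse> \<subseteq> {..<n} \<times> {..<n}" using assms unfolding U_def by force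
  have "U \<inter> U\<inverse> = {}" unfolding U_def by auto
  then have "card (U \<union> U\<inverse>) = 2 * card U" using U by (simp add: card_Un_disjoint)
  moreover have "card C + card (U \<union> U\<inverse>) = card ({..<n} \<times> {..<n})"
    using U(1) sub card_mono[OF finite_SigmaI[OF finite_lessThan finite_lessThan] sub] unfolding C
    by (subst card_Diff_subset) simp_all
  ultimately show ?thesis using U by (simp add: C_def power2_eq_square)
qed

theorem theorem3p7:
  fixes n :: nat
  assumes "n \<ge> 3"
  shows "\<forall>r \<in> CD n. \<exists>(A :: nat set) mult zero.
           bck_algebra A mult zero \<and> finite A \<and> card A = n \<and> commuting_degree A mult = r"
proof
  fix r assume "r \<in> CD n"
  then obtain k :: int where r: "r = ((real n)\<^sup>2 - 2 * real_of_int k) / (real n)\<^sup>2"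
    and k: "1 \<le> k" "k \<le> (int n - 2) * (int n - 1) div 2"
    unfolding CD_altdef[OF assms] by blast
  define m where "m = n - 2"
  have m: "n = Suc (Suc m)" using assms by (simp add: m_def)
  have "\<Sum>{..<n - 1} = m * (m + 1) div 2"
    using gauss_sum_nat[of m] by (simp add: m lessThan_Suc_atMost atLeast0AtMost)
  moreover have "(int n - 2) * (int n - 1) div 2 = int (m * (m + 1) div 2)"
    by (simp add: m zdiv_int algebra_simps)
  ultimately have "nat k \<le> \<Sum>{..<n - 1}" using k by linarith
  then obtain S where S: "S \<subseteq> {..<n - 1}" "\<Sum>S = nat k" using subset_sum_lessThan by blast
  \<comment> \<open>A summand \<open>s\<close> is realised by the top \<open>Suc s\<close>, which
    has exactly \<open>s\<close> nonzero elements strictly below it.\<close>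
  have "(\<Sum>y\<in>Suc ` S. y - 1) = nat k" using S(2) by (simp add: sum.reindex)
  moreover have sub: "Suc ` S \<subseteq> {..<n}" using S(1) by auto
  ultimately have "card (commuting_pairs {..<n} (poset_mult (top_le (Suc ` S)) 0)) + 2 * nat k = n\<^sup>2"
    using card_commuting_pairs_top_le[OF sub] by simp
  then have "real (card (commuting_pairs {..<n} (poset_mult (top_le (Suc ` S)) 0)))
      = (real n)\<^sup>2 - 2 * real_of_int k"
    using k(1) by (simp flip: of_nat_power)
  then have "commuting_degree {..<n} (poset_mult (top_le (Suc ` S)) 0) = r"
    by (simp add: commuting_degree_def r)
  moreover have "bck_algebra {..<n} (poset_mult (top_le (Suc ` S)) 0) 0"
    using assms by (intro bck_algebra_top_le) simp
  moreover have "finite {..<n}" "card {..<n} = n" by simp_all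
  ultimately show "\<exists>(A :: nat set) mult zero.
      bck_algebra A mult zero \<and> finite A \<and> card A = n \<and> commuting_degree A mult = r"
    by blast
qed

end
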